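(* Let $G$ and $H$ be noncomplete and nonempty graphs on $n$ vertices, where $G$ is $d$-regular, $H$ is $d'$-regular, and $d' \leq d$. If $H$ is a spanning subgraph of $G$, then $$\frac{n\,\bigl(1+\lambda_2(G)\bigr)}{n-d+\lambda_2(G)} + \frac{d'}{\lambda_n(H)} \geq 1,$$ where $\lambda_2(G)$ is the second-largest eigenvalue of the adjacency matrix of $G$, and $\lambda_n(H)$ is the smallest eigenvalue of the adjacency matrix of $H$.
   Context: All graphs are finite, simple and undirected. A graph is nonempty if it has at least one edge. The eigenvalues of the adjacency matrix of a graph on $n$ vertices are listed with multiplicity in decreasing order $\lambda_1 \ge \lambda_2 \ge \cdots \ge \lambda_n$. A graph $H$ is a spanning subgraph of $G$ if $H$ and $G$ have the same vertex set and every edge of $H$ is an edge of $G$. *)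

theory Defs
  imports
    "Graph_Theory.Graph_Theory"
    "Jordan_Normal_Form.Char_Poly"
begin

text \<open>
  A finite simple undirected graph is a \<^locale>\<open>pair_graph\<close>: an irreflexive symmetric digraph on a
  finite vertex set, in which an undirected edge \<open>{u, v}\<close> is represented by the two arcs
  \<open>(u, v)\<close> and \<open>(v, u)\<close>. Hence the degree of a vertex is its out-degree.
\<close>

definition nonempty_graph :: "'a pair_pre_digraph \<Rightarrow> bool" where
  "nonempty_graph G \<longleftrightarrow> parcs G \<noteq> {}"

definition complete_graph :: "'a pair_pre_digraph \<Rightarrow> bool" where
  "complete_graph G \<longleftrightarrow> complete_digraph (card (pverts G)) (with_proj G)"

definition regular_graph :: "nat \<Rightarrow> 'a pair_pre_digraph \<Rightarrow> bool" where
  "regular_graph d G \<longleftrightarrow> (\<forall>v\<in>pverts G. out_degree (with_proj G) v = d)"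

definition adjacency_mat :: "'a pair_pre_digraph \<Rightarrow> 'a list \<Rightarrow> real mat" where
  "adjacency_mat G vs = mat (length vs) (length vs)
     (\<lambda>(i, j). if (vs ! i, vs ! j) \<in> parcs G then 1 else 0)"

definition vertex_enum :: "'a pair_pre_digraph \<Rightarrow> 'a list" where
  "vertex_enum G = (SOME vs. distinct vs \<and> set vs = pverts G)"

text \<open>
  The eigenvalues of the adjacency matrix, with (algebraic) multiplicity, in decreasing order. By
  \<open>graph_eigenvalues_eq\<close> below, the list does not depend on how the vertices are enumerated,
  and by \<open>length_graph_eigenvalues\<close> it has exactly one entry per vertex.
\<close>
definition graph_eigenvalues :: "'a pair_pre_digraph \<Rightarrow> real list" where
  "graph_eigenvalues G =
     rev (sorted_list_of_multiset (proots (char_poly (adjacency_mat G (vertex_enum G)))))"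

text \<open>The usual indexing \<open>\<lambda>\<^sub>1 \<ge> \<dots> \<ge> \<lambda>\<^sub>n\<close> starts at 1, whereas list positions start at 0.\<close>
definition graph_eigenvalue :: "nat \<Rightarrow> 'a pair_pre_digraph \<Rightarrow> real" where
  "graph_eigenvalue k G = graph_eigenvalues G ! (k - 1)"

lemma vertex_enum:
  assumes "finite (pverts G)"
  shows "distinct (vertex_enum G)" "set (vertex_enum G) = pverts G"
proof -
  have "\<exists>vs. distinct vs \<and> set vs = pverts G"
    using finite_distinct_list[OF assms] by blast
  from someI_ex[OF this] show "distinct (vertex_enum G)" "set (vertex_enum G) = pverts G"
    unfolding vertex_enum_def by auto
qed

lemma adjacency_mat_carrier [simp]: "adjacency_mat G vs \<in> carrier_mat (length vs) (length vs)"
  by (simp add: adjacency_mat_def)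

lemma similar_adjacency_mat:
  assumes vs: "distinct vs" and ws: "distinct ws" and eq: "set vs = set ws"
  shows "similar_mat (adjacency_mat G vs) (adjacency_mat G ws)"
proof -
  define n where "n = length vs"
  have n: "length vs = n" "length ws = n"
    using vs ws eq by (auto simp: n_def dest!: distinct_card)
  define B where "B = adjacency_mat G ws"
  define P Q :: "real mat"
    where "P = mat n n (\<lambda>(i, j). if vs ! i = ws ! j then 1 else 0)"
      and "Q = mat n n (\<lambda>(i, j). if ws ! i = vs ! j then 1 else 0)"
  have "\<exists>k<n. ws ! k = vs ! i" if "i < n" for i
    using that n eq by (metis in_set_conv_nth)
  then obtain p where p: "\<And>i. i < n \<Longrightarrow> p i < n \<and> ws ! (p i) = vs ! i" by metis
  have "\<exists>k<n. vs ! k = ws ! i" if "i < n" for i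
    using that n eq by (metis in_set_conv_nth)
  then obtain q where q: "\<And>i. i < n \<Longrightarrow> q i < n \<and> vs ! (q i) = ws ! i" by metis
  have peq: "vs ! i = ws ! k \<longleftrightarrow> k = p i" if "i < n" "k < n" for i k
    using p[OF that(1)] that ws n by (metis nth_eq_iff_index_eq)
  have qeq: "ws ! i = vs ! k \<longleftrightarrow> k = q i" if "i < n" "k < n" for i k
    using q[OF that(1)] that vs n by (metis nth_eq_iff_index_eq)
  have left: "P * M = mat n n (\<lambda>(i, j). M $$ (p i, j))" if "M \<in> carrier_mat n n" for M
  proof (rule eq_matI)
    fix i j assume ij: "i < dim_row (mat n n (\<lambda>(i, j). M $$ (p i, j)))"
      "j < dim_col (mat n n (\<lambda>(i, j). M $$ (p i, j)))"
    have "(P * M) $$ (i, j) = (\<Sum>k = 0..<n. (if vs ! i = ws ! k then 1 else 0) * M $$ (k, j))"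
      using ij that by (auto simp: P_def scalar_prod_def)
    also have "\<dots> = (\<Sum>k = 0..<n. if k = p i then M $$ (k, j) else 0)"
      using ij peq by (intro sum.cong) auto
    also have "\<dots> = M $$ (p i, j)" using p[of i] ij by simp
    finally show "(P * M) $$ (i, j) = mat n n (\<lambda>(i, j). M $$ (p i, j)) $$ (i, j)"
      using ij by simp
  qed (use that in \<open>auto simp: P_def\<close>)
  have right: "M * Q = mat n n (\<lambda>(i, j). M $$ (i, p j))" if "M \<in> carrier_mat n n" for M
  proof (rule eq_matI)
    fix i j assume ij: "i < dim_row (mat n n (\<lambda>(i, j). M $$ (i, p j)))"
      "j < dim_col (mat n n (\<lambda>(i, j). M $$ (i, p j)))"
    have "(M * Q) $$ (i, j) = (\<Sum>k = 0..<n. M $$ (i, k) * (if vs ! j = ws ! k then 1 else 0))"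
      using ij that by (simp add: Q_def scalar_prod_def eq_commute[of "vs ! j"])
    also have "\<dots> = (\<Sum>k = 0..<n. if k = p j then M $$ (i, k) else 0)"
      using ij peq by (intro sum.cong) auto
    also have "\<dots> = M $$ (i, p j)" using p[of j] ij by simp
    finally show "(M * Q) $$ (i, j) = mat n n (\<lambda>(i, j). M $$ (i, p j)) $$ (i, j)"
      using ij by simp
  qed (use that in \<open>auto simp: Q_def\<close>)
  have c: "P \<in> carrier_mat n n" "Q \<in> carrier_mat n n" "B \<in> carrier_mat n n"
    "adjacency_mat G vs \<in> carrier_mat n n"
    using n by (auto simp: P_def Q_def B_def adjacency_mat_def)
  have PQ: "P * Q = 1\<^sub>m n"
    unfolding left[OF c(2)]
    by (rule eq_matI) (use p vs n in \<open>auto simp: Q_def nth_eq_iff_index_eq\<close>)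
  have QP: "Q * P = 1\<^sub>m n"
    using mat_mult_left_right_inverse[OF c(1,2) PQ] .
  have "adjacency_mat G vs = P * B * Q"
    unfolding right[OF mult_carrier_mat[OF c(1,3)]] unfolding left[OF c(3)]
    by (rule eq_matI) (use p n in \<open>auto simp: B_def adjacency_mat_def\<close>)
  with PQ QP c have "similar_mat_wit (adjacency_mat G vs) B P Q"
    unfolding similar_mat_wit_def by (auto simp: Let_def)
  then show ?thesis unfolding similar_mat_def B_def by blast
qed

lemma graph_eigenvalues_eq:
  assumes "distinct vs" "set vs = pverts G"
  shows "graph_eigenvalues G =
    rev (sorted_list_of_multiset (proots (char_poly (adjacency_mat G vs))))"
proof -
  have fin: "finite (pverts G)" using assms(2) by (metis List.finite_set)
  have "similar_mat (adjacency_mat G (vertex_enum G)) (adjacency_mat G vs)"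
    using vertex_enum[OF fin] assms by (intro similar_adjacency_mat) auto
  then show ?thesis unfolding graph_eigenvalues_def by (simp add: char_poly_similar)
qed

lemma char_poly_symmetric_splits:
  fixes A :: "real mat"
  assumes A: "A \<in> carrier_mat n n" and sym: "transpose_mat A = A"
  shows "\<exists>as. char_poly A = (\<Prod>a\<leftarrow>as. [:- a, 1:]) \<and> length as = n"
proof -
  define C where "C = map_mat complex_of_real A"
  have C: "C \<in> carrier_mat n n" using A by (simp add: C_def)
  obtain as where as: "char_poly C = (\<Prod>a\<leftarrow>as. [:- a, 1:])" "length as = n"
    using char_poly_factorized[OF C] by blast
  have real: "a = complex_of_real (Re a)" if "a \<in> set as" for a
  proof -
    have "poly (char_poly C) a = 0"
      using that unfolding as(1) by (auto simp: poly_prod_list prod_list_zero_iff)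
    then obtain v where "eigenvector C v a"
      using eigenvalue_root_char_poly[OF C] unfolding eigenvalue_def by blast
    then have v: "v \<in> carrier_vec n" "v \<noteq> 0\<^sub>v n" and ev: "C *\<^sub>v v = a \<cdot>\<^sub>v v"
      using C by (auto simp: eigenvector_def)
    have symC: "transpose_mat C = C" 
    proof (rule eq_matI)
      fix i j assume "i < dim_row C" "j < dim_col C"
      then have ij: "i < n" "j < n" using C by auto
      have "transpose_mat A $$ (i, j) = A $$ (j, i)" using ij A by simp
      then show "transpose_mat C $$ (i, j) = C $$ (i, j)" using ij A sym by (simp add: C_def)
    qed (use C in auto)
    have ev': "C *\<^sub>v conjugate v = conjugate a \<cdot>\<^sub>v conjugate v"
    proof (rule eq_vecI)
      fix i assume "i < dim_vec (conjugate a \<cdot>\<^sub>v conjugate v)"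
      then have i: "i < n" using v by simp
      have "(C *\<^sub>v conjugate v) $ i = conjugate ((C *\<^sub>v v) $ i)"
        using i v A by (auto simp: C_def scalar_prod_def)
      then show "(C *\<^sub>v conjugate v) $ i = (conjugate a \<cdot>\<^sub>v conjugate v) $ i"
        using i v by (simp add: ev)
    qed (use C v in auto)
    have "a * (v \<bullet> conjugate v) = (C *\<^sub>v v) \<bullet> conjugate v" using v by (simp add: ev)
    also have "\<dots> = v \<bullet> (C *\<^sub>v conjugate v)"
      using transpose_vec_mult_scalar[OF C, of "conjugate v" v] v symC by simp
    also have "\<dots> = cnj a * (v \<bullet> conjugate v)" using v by (simp add: ev')
    finally have "a = cnj a" using conjugate_square_eq_0_vec[OF v(1)] v(2) by simp
    then show ?thesis by (simp add: complex_eq_iff)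
  qed
  interpret poly_hom: map_poly_inj_idom_hom complex_of_real ..
  have "map_poly complex_of_real (char_poly A) = char_poly C"
    unfolding C_def by (rule of_real_hom.char_poly_hom[OF A, symmetric])
  also have "\<dots> = (\<Prod>a\<leftarrow>as. map_poly complex_of_real [:- Re a, 1:])"
    unfolding as(1)
    by (rule arg_cong[where f = prod_list], rule map_cong[OF refl])
       (use real in \<open>simp add: map_poly_pCons\<close>)
  also have "\<dots> = map_poly complex_of_real (\<Prod>a\<leftarrow>map Re as. [:- a, 1:])"
    by (simp only: poly_hom.hom_prod_list list.map_comp comp_def)
  finally have "char_poly A = (\<Prod>a\<leftarrow>map Re as. [:- a, 1:])"
    by (simp only: poly_hom.eq_iff)
  then show ?thesis using as(2) by (metis length_map)
qed

lemma (in pair_graph) length_graph_eigenvalues: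
  "length (graph_eigenvalues G) = card (pverts G)"
proof -
  let ?vs = "vertex_enum G"
  note vs = vertex_enum[OF pair_finite_verts]
  have sym: "(u, v) \<in> parcs G \<longleftrightarrow> (v, u) \<in> parcs G" for u v
    using pair_sym_arcs by (auto simp: symmetric_def sym_def)
  have "transpose_mat (adjacency_mat G ?vs) = adjacency_mat G ?vs"
    by (rule eq_matI) (auto simp: adjacency_mat_def sym)
  from char_poly_symmetric_splits[OF adjacency_mat_carrier this] obtain as
    where as: "char_poly (adjacency_mat G ?vs) = (\<Prod>a\<leftarrow>as. [:- a, 1:])"
      "length as = length ?vs" by blast
  have "proots (\<Prod>a\<leftarrow>as. [:- a, 1:]) = mset as"
  proof (induction as)
    case (Cons a as)
    have "(\<Prod>a\<leftarrow>as. [:- a, 1:]) \<noteq> 0" by (auto simp: prod_list_zero_iff)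
    then have "proots ([:- a, 1:] * (\<Prod>a\<leftarrow>as. [:- a, 1:])) =
        proots [:- a, 1:] + proots (\<Prod>a\<leftarrow>as. [:- a, 1:])"
      by (intro proots_mult) auto
    then show ?case unfolding list.map prod_list.Cons by (simp only: Cons.IH) simp
  qed simp
  then have "length (graph_eigenvalues G) = length as"
    unfolding graph_eigenvalues_def as(1) by (simp flip: size_mset)
  also have "\<dots> = card (pverts G)" using as(2) vs distinct_card by metis
  finally show ?thesis .
qed

end

theory Submission
  imports Defs
begin

text \<open>
  Write \<open>A\<close> and \<open>B\<close> for the adjacency matrices of \<open>G\<close> and \<open>H\<close>, \<open>J\<close> for the all-ones matrix,
  \<open>\<theta> = \<lambda>\<^sub>2(G)\<close> and \<open>\<mu> = \<lambda>\<^sub>n(H)\<close>. The proof pairs two positive semidefinite matrices: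
  \<^item> \<open>B - \<mu> I\<close>, because \<open>\<mu>\<close> is the least eigenvalue of \<open>B\<close>;
  \<^item> \<open>N = \<theta> I + ((d - \<theta>) / n) J - A\<close>, because the all-ones vector is an eigenvector of \<open>A\<close> for its
    largest eigenvalue \<open>d\<close>, is killed by \<open>N\<close>, and on its orthogonal complement \<open>A\<close> is at most \<open>\<theta>\<close>.

  The trace of the product of two positive semidefinite matrices is nonnegative. Every edge of \<open>H\<close>
  is an edge of \<open>G\<close>, so the entrywise product of \<open>A\<close> and \<open>B\<close> is \<open>B\<close>, and the trace of
  \<open>N (B - \<mu> I)\<close> can be computed from \<open>n\<close>, \<open>d\<close>, \<open>d'\<close>, \<open>\<theta>\<close> and \<open>\<mu>\<close> alone. The outcome is
  \<open>(n - d + \<theta>) (d' - \<mu>) \<le> n (1 + \<theta>) (- \<mu>)\<close>, and the claim follows on dividing by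
  \<open>(n - d + \<theta>) (- \<mu>)\<close>. This number is positive: evaluating the quadratic form of \<open>A\<close> at the
  difference of two nonadjacent vertices gives \<open>\<theta> \<ge> 0\<close>, and evaluating that of \<open>B\<close> at the
  difference of two adjacent vertices gives \<open>\<mu> \<le> - 1\<close>. In terms of the Lovasz theta function of the
  complements, this is weak duality between a feasible solution obtained from \<open>H\<close> and one obtained
  from \<open>G\<close>.

  The two facts about quadratic forms are \<open>quadratic_form_le_second\<close> and \<open>trace_product_nonneg\<close>.
  Eigenvalues are given as roots of a characteristic polynomial, with multiplicity, so both rest on
  an orthonormal eigenbasis listed in the order of these roots (\<open>real_spectral_theorem\<close>).
\<close>

section \<open>The spectral theorem for real symmetric matrices\<close>

text \<open>
  The Householder reflection that swaps \<open>u\<close> with the first basis vector. A reflection is its own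
  transpose and its own inverse, which keeps the conjugation in the deflation step below simple.
\<close>
lemma orthogonal_mat_with_first_column:
  fixes u :: "real vec"
  assumes u: "u \<in> carrier_vec n" and unit: "u \<bullet> u = 1" and n: "0 < n"
  obtains U where "U \<in> carrier_mat n n" "transpose_mat U = U" "U * U = 1\<^sub>m n" "col U 0 = u"
proof -
  define w where "w = (\<lambda>i. u $ i - (if i = 0 then 1 else 0))"
  define s where "s = (\<Sum>k<n. w k * w k)"
  \<comment> \<open>If \<open>u\<close> is the first basis vector, then \<open>w = 0\<close>, and division by zero makes \<open>U\<close> the identity.\<close>
  define c where "c = 2 / s"
  define U where "U = mat n n (\<lambda>(i, j). (if i = j then 1 else 0) - c * w i * w j)"
  have U: "U \<in> carrier_mat n n" by (simp add: U_def)
  have "(\<Sum>k<n. u $ k * u $ k) = 1"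
    using unit u by (simp add: scalar_prod_def atLeast0LessThan)
  moreover have "s = (\<Sum>k<n. u $ k * u $ k) - (\<Sum>k<n. if k = 0 then 2 * u $ k - 1 else 0)"
    unfolding s_def w_def sum_subtractf[symmetric]
    by (intro sum.cong) (auto simp: algebra_simps)
  ultimately have s: "s = - 2 * w 0"
    using n by (simp add: w_def)
  have cs: "c * c * s = 2 * c" by (simp add: c_def)
  have w0: "w i = 0" if "s = 0" "i < n" for i
  proof -
    have "\<forall>k\<in>{..<n}. w k * w k = 0"
      using that(1) unfolding s_def by (subst (asm) sum_nonneg_eq_0_iff) auto
    then show ?thesis using that(2) by simp
  qed
  have sym: "transpose_mat U = U"
    by (rule eq_matI) (auto simp: U_def)
  have inv: "U * U = 1\<^sub>m n"
  proof (rule eq_matI)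
    fix i j assume "i < dim_row (1\<^sub>m n :: real mat)" "j < dim_col (1\<^sub>m n :: real mat)"
    then have ij: "i < n" "j < n" by auto
    have "(U * U) $$ (i, j) = (\<Sum>k<n. ((if i = k then 1 else 0) - c * w i * w k)
        * ((if k = j then 1 else 0) - c * w k * w j))"
      using ij by (simp add: U_def scalar_prod_def atLeast0LessThan)
    also have "\<dots> = (\<Sum>k<n. (if k = i then (if i = j then 1 else 0) - c * w i * w j else 0)
        - (if k = j then c * w i * w j else 0) + c * c * w i * w j * (w k * w k))"
      by (intro sum.cong) (auto simp: algebra_simps)
    also have "\<dots> = (if i = j then 1 else 0) - 2 * c * w i * w j + c * c * w i * w j * s"
      unfolding sum.distrib sum_subtractf s_def sum_distrib_left[symmetric] using ij by simp
    also have "c * c * w i * w j * s = 2 * c * w i * w j"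
      using cs by (metis (no_types, opaque_lifting) mult.assoc mult.commute)
    finally show "(U * U) $$ (i, j) = 1\<^sub>m n $$ (i, j)" using ij by simp
  qed (use U in auto)
  have "col U 0 = u"
  proof (rule eq_vecI)
    fix i assume "i < dim_vec u"
    then have i: "i < n" using u by simp
    have "col U 0 $ i = (if i = 0 then 1 else 0) - c * w 0 * w i"
      using i n by (simp add: U_def)
    also have "\<dots> = (if i = 0 then 1 else 0) + w i"
    proof (cases "s = 0")
      case True then show ?thesis using w0 i by simp
    next
      case False
      then have "c * w 0 = - 1" using s by (simp add: c_def field_simps)
      then show ?thesis by simp
    qed
    finally show "col U 0 $ i = u $ i" by (simp add: w_def)
  qed (use U u in simp)
  with that U sym inv show thesis by blast
qed

lemma eigenvalue_unit_eigenvector: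
  fixes A :: "real mat"
  assumes A: "A \<in> carrier_mat n n" and "eigenvalue A e"
  obtains u where "u \<in> carrier_vec n" "u \<bullet> u = 1" "A *\<^sub>v u = e \<cdot>\<^sub>v u"
proof -
  obtain v where v: "v \<in> carrier_vec n" "v \<noteq> 0\<^sub>v n" "A *\<^sub>v v = e \<cdot>\<^sub>v v"
    using assms by (auto simp: eigenvalue_def eigenvector_def)
  have "v \<bullet> v > 0"
    using conjugate_square_greater_0_vec[OF v(1)] v(2) by simp
  define r where "r = 1 / sqrt (v \<bullet> v)"
  have "(r \<cdot>\<^sub>v v) \<bullet> (r \<cdot>\<^sub>v v) = r * r * (v \<bullet> v)" using v by simp
  also have "\<dots> = 1" using \<open>v \<bullet> v > 0\<close> by (simp add: r_def)
  finally have "(r \<cdot>\<^sub>v v) \<bullet> (r \<cdot>\<^sub>v v) = 1" .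
  moreover have "A *\<^sub>v (r \<cdot>\<^sub>v v) = e \<cdot>\<^sub>v (r \<cdot>\<^sub>v v)"
    using A v by (simp add: mult_mat_vec smult_smult_assoc mult.commute)
  ultimately show thesis using that v(1) by (metis smult_carrier_vec)
qed

text \<open>
  Deflation: conjugating by an orthogonal matrix whose first column is a unit eigenvector for \<open>e\<close>
  splits off a \<open>1 \<times> 1\<close> block, where symmetry makes the first row vanish along with the first column.
  The eigenvalue \<open>e\<close> can be chosen freely at each step, hence the diagonal follows any prescribed
  order of the roots; this is what links positions in a sorted list of eigenvalues to eigenvectors.
\<close>
lemma real_spectral_theorem:
  fixes A :: "real mat"
  assumes "A \<in> carrier_mat n n" and "transpose_mat A = A"
    and "char_poly A = (\<Prod>a\<leftarrow>es. [:- a, 1:])"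
  shows "\<exists>U \<in> carrier_mat n n. transpose_mat U * U = 1\<^sub>m n \<and>
    transpose_mat U * A * U = mat n n (\<lambda>(i, j). if i = j then es ! i else 0)"
  using assms
proof (induction es arbitrary: n A)
  case Nil
  then have "n = 0" using degree_monic_char_poly[OF Nil.prems(1)] by simp
  with Nil.prems(1) show ?case by (intro bexI[of _ "1\<^sub>m 0"] conjI eq_matI) auto
next
  case (Cons e es)
  note A = Cons.prems(1) and sym = Cons.prems(2) and cp = Cons.prems(3)
  have ev: "eigenvalue A e"
    unfolding eigenvalue_root_char_poly[OF A] cp by simp
  have "n \<noteq> 0"
  proof
    assume "n = 0"
    then have "A *\<^sub>v v = e \<cdot>\<^sub>v v \<longrightarrow> v \<notin> carrier_vec n \<or> v = 0\<^sub>v n" for v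
      by auto
    then show False using ev A by (auto simp: eigenvalue_def eigenvector_def)
  qed
  then obtain m where n: "n = 1 + m" by (cases n) auto
  obtain u where u: "u \<in> carrier_vec n" "u \<bullet> u = 1" "A *\<^sub>v u = e \<cdot>\<^sub>v u"
    using eigenvalue_unit_eigenvector[OF A ev] .
  obtain U where U: "U \<in> carrier_mat n n" "transpose_mat U = U" "U * U = 1\<^sub>m n" "col U 0 = u"
    using orthogonal_mat_with_first_column[OF u(1,2)] n by (metis zero_less_Suc plus_1_eq_Suc)
  define A' where "A' = U * A * U"
  have A': "A' \<in> carrier_mat n n" using U A by (simp add: A'_def)
  have symA': "transpose_mat A' = A'"
    using U A sym unfolding A'_def
    by (simp add: transpose_mult[of _ n n _ n] assoc_mult_mat[of _ n n _ n _ n])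
  have "col A' 0 = (U * A) *\<^sub>v u"
    unfolding A'_def using col_mult2[OF mult_carrier_mat[OF U(1) A] U(1), of 0] U(4) n
    by (metis plus_1_eq_Suc zero_less_Suc)
  also have "\<dots> = U *\<^sub>v (e \<cdot>\<^sub>v u)"
    using assoc_mult_mat_vec[OF U(1) A u(1)] u(3) by simp
  also have "\<dots> = e \<cdot>\<^sub>v (U *\<^sub>v col U 0)" using mult_mat_vec[OF U(1) u(1)] U(4) by simp
  also have "U *\<^sub>v col U 0 = unit_vec n 0"
    using col_mult2[OF U(1) U(1), of 0] U(3) n by simp
  finally have col0: "col A' 0 = e \<cdot>\<^sub>v unit_vec n 0" .
  have A'col: "A' $$ (i, 0) = (if i = 0 then e else 0)" if "i < n" for i
    using arg_cong[OF col0, of "\<lambda>v. v $ i"] that A' n by (simp add: index_unit_vec)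
  have A'row: "A' $$ (0, i) = (if i = 0 then e else 0)" if "i < n" for i
  proof -
    have "A' $$ (0, i) = transpose_mat A' $$ (i, 0)" using that A' n by simp
    then show ?thesis using A'col[OF that] symA' by simp
  qed
  define E where "E = mat 1 1 (\<lambda>_. e)"
  define B where "B = mat m m (\<lambda>(i, j). A' $$ (Suc i, Suc j))"
  have EB: "E \<in> carrier_mat 1 1" "B \<in> carrier_mat m m" by (auto simp: E_def B_def)
  have block: "A' = four_block_mat E (0\<^sub>m 1 m) (0\<^sub>m m 1) B"
    by (rule eq_matI) (use A' n A'col A'row in \<open>auto simp: E_def B_def\<close>)
  have symB: "transpose_mat B = B"
  proof (rule eq_matI)
    fix i j assume "i < dim_row B" "j < dim_col B"
    then have ij: "i < m" "j < m" by (auto simp: B_def)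
    have "A' $$ (Suc j, Suc i) = transpose_mat A' $$ (Suc i, Suc j)" using ij A' n by simp
    then show "transpose_mat B $$ (i, j) = B $$ (i, j)" using ij symA' by (simp add: B_def)
  qed (auto simp: B_def)
  have "similar_mat_wit A' A U U"
    using U A A' by (intro similar_mat_witI[of _ _ n]) (auto simp: A'_def)
  then have "char_poly A' = char_poly A"
    using char_poly_similar unfolding similar_mat_def by blast
  moreover have "char_poly A' = char_poly E * char_poly B"
    unfolding block using EB by (intro char_poly_four_block_zeros_col) auto
  moreover have "char_poly E = [:- e, 1:]"
    by (simp add: E_def char_poly_defs det_def sign_def)
  ultimately have "char_poly B = (\<Prod>a\<leftarrow>es. [:- a, 1:])"
    using cp by (metis (no_types, lifting) list.simps(9) mult_cancel_left pCons_eq_0_iff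
        prod_list.Cons zero_neq_one)
  from Cons.IH[OF EB(2) symB this] obtain P where P: "P \<in> carrier_mat m m"
    "transpose_mat P * P = 1\<^sub>m m"
    "transpose_mat P * B * P = mat m m (\<lambda>(i, j). if i = j then es ! i else 0)" by blast
  define Q where "Q = four_block_mat (1\<^sub>m 1) (0\<^sub>m 1 m) (0\<^sub>m m 1) P"
  have Q: "Q \<in> carrier_mat n n" using P n by (auto simp: Q_def)
  have Qt: "transpose_mat Q = four_block_mat (1\<^sub>m 1) (0\<^sub>m 1 m) (0\<^sub>m m 1) (transpose_mat P)"
    unfolding Q_def using P by (subst transpose_four_block_mat[of _ 1 1 _ m _ m]) auto
  have QQ: "transpose_mat Q * Q = 1\<^sub>m n"
    unfolding Qt unfolding Q_def using P
    by (subst mult_four_block_mat[of _ 1 1 _ m _ m _ _ 1 _ m]) (auto simp: n)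
  have QA: "transpose_mat Q * A' * Q =
      four_block_mat E (0\<^sub>m 1 m) (0\<^sub>m m 1) (transpose_mat P * B * P)"
    unfolding Qt block unfolding Q_def using P EB
    by (subst mult_four_block_mat[of _ 1 1 _ m _ m _ _ 1 _ m], auto)+
  have "transpose_mat (U * Q) = transpose_mat Q * U"
    using U Q by (simp add: transpose_mult[of _ n n _ n])
  moreover have "transpose_mat Q * U * (U * Q) = transpose_mat Q * (U * U) * Q"
    using U(1) Q by (simp add: assoc_mult_mat[of _ n n _ n _ n])
  moreover have "transpose_mat Q * U * A * (U * Q) = transpose_mat Q * A' * Q"
    using U(1) Q A by (simp add: A'_def assoc_mult_mat[of _ n n _ n _ n])
  moreover have "four_block_mat E (0\<^sub>m 1 m) (0\<^sub>m m 1) (transpose_mat P * B * P) =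
      mat n n (\<lambda>(i, j). if i = j then (e # es) ! i else 0)"
    unfolding P(3) by (rule eq_matI) (auto simp: E_def n)
  ultimately show ?case
    using U Q QQ QA by (intro bexI[of _ "U * Q"]) auto
qed

text \<open>
  The spectral theorem in coordinates: \<open>w k\<close> is the eigenvector for \<open>lam k\<close>, and the three
  assumptions express \<open>U\<^sup>T U = I\<close>, \<open>U U\<^sup>T = I\<close> and \<open>A = U D U\<^sup>T\<close> for the matrix \<open>U\<close> with columns \<open>w k\<close>.
  Finite sums over indices take the place of matrix products from here on.
\<close>
locale spectral_decomposition =
  fixes n :: nat and A :: "nat \<Rightarrow> nat \<Rightarrow> real" and lam :: "nat \<Rightarrow> real"
    and w :: "nat \<Rightarrow> nat \<Rightarrow> real"
  assumes orthonormal: "k < n \<Longrightarrow> l < n \<Longrightarrow> (\<Sum>i<n. w k i * w l i) = (if k = l then 1 else 0)"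
    and complete: "i < n \<Longrightarrow> j < n \<Longrightarrow> (\<Sum>k<n. w k i * w k j) = (if i = j then 1 else 0)"
    and expansion: "i < n \<Longrightarrow> j < n \<Longrightarrow> A i j = (\<Sum>k<n. lam k * w k i * w k j)"

lemma symmetric_mat_spectral_decomposition:
  fixes A :: "real mat"
  assumes A: "A \<in> carrier_mat n n" and sym: "transpose_mat A = A"
    and cp: "char_poly A = (\<Prod>a\<leftarrow>es. [:- a, 1:])"
  obtains w where "spectral_decomposition n (\<lambda>i j. A $$ (i, j)) (nth es) w"
proof -
  define D where "D = mat n n (\<lambda>(i, j). if i = j then es ! i else 0)"
  obtain U where U: "U \<in> carrier_mat n n" "transpose_mat U * U = 1\<^sub>m n"
    and UAU: "transpose_mat U * A * U = D"
    using real_spectral_theorem[OF assms] unfolding D_def by blast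
  have Ut: "transpose_mat U \<in> carrier_mat n n" and D: "D \<in> carrier_mat n n"
    using U by (auto simp: D_def)
  have UU: "U * transpose_mat U = 1\<^sub>m n"
    using mat_mult_left_right_inverse[OF Ut U(1,2)] .
  have "U * D * transpose_mat U = (U * transpose_mat U) * A * (U * transpose_mat U)"
    unfolding UAU[symmetric] using U(1) Ut A by (simp add: assoc_mult_mat[of _ n n _ n _ n])
  then have AUD: "A = U * D * transpose_mat U" using UU A by simp
  have UD: "(U * D) $$ (i, k) = es ! k * U $$ (i, k)" if "i < n" "k < n" for i k
  proof -
    have "(U * D) $$ (i, k) = (\<Sum>l<n. U $$ (i, l) * (if l = k then es ! l else 0))"
      using that U by (simp add: D_def scalar_prod_def atLeast0LessThan)
    also have "\<dots> = (\<Sum>l<n. if l = k then es ! l * U $$ (i, l) else 0)"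
      by (intro sum.cong) auto
    finally show ?thesis using that by simp
  qed
  have "spectral_decomposition n (\<lambda>i j. A $$ (i, j)) (nth es) (\<lambda>k i. U $$ (i, k))"
  proof
    fix k l assume kl: "k < n" "l < n"
    then show "(\<Sum>i<n. U $$ (i, k) * U $$ (i, l)) = (if k = l then 1 else 0)"
      using arg_cong[OF U(2), of "\<lambda>M. M $$ (k, l)"] U(1)
      by (simp add: scalar_prod_def atLeast0LessThan)
  next
    fix i j assume ij: "i < n" "j < n"
    then show "(\<Sum>k<n. U $$ (i, k) * U $$ (j, k)) = (if i = j then 1 else 0)"
      using arg_cong[OF UU, of "\<lambda>M. M $$ (i, j)"] U(1)
      by (simp add: scalar_prod_def atLeast0LessThan)
    have "A $$ (i, j) = row (U * D) i \<bullet> col (transpose_mat U) j"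
      using ij U(1) D by (subst AUD) (simp only: index_mult_mat index_transpose_mat carrier_matD)
    also have "\<dots> = (\<Sum>k<n. (U * D) $$ (i, k) * U $$ (j, k))"
      unfolding scalar_prod_def atLeast0LessThan using ij U(1) mult_carrier_mat[OF U(1) D]
      by (intro sum.cong) (auto simp del: index_mult_mat(1))
    also have "\<dots> = (\<Sum>k<n. es ! k * U $$ (i, k) * U $$ (j, k))"
      using UD ij by (intro sum.cong) auto
    finally show "A $$ (i, j) = (\<Sum>k<n. es ! k * U $$ (i, k) * U $$ (j, k))" .
  qed
  then show thesis using that by blast
qed

context spectral_decomposition
begin

definition coord :: "nat \<Rightarrow> (nat \<Rightarrow> real) \<Rightarrow> real" where
  "coord k x = (\<Sum>i<n. w k i * x i)"

lemma parseval: "(\<Sum>i<n. x i * y i) = (\<Sum>k<n. coord k x * coord k y)"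
proof -
  have "(\<Sum>k<n. coord k x * coord k y)
      = (\<Sum>k<n. \<Sum>i<n. \<Sum>j<n. x i * y j * (w k i * w k j))"
    unfolding coord_def sum_product by (intro sum.cong) (auto simp: mult_ac)
  also have "\<dots> = (\<Sum>i<n. \<Sum>k<n. \<Sum>j<n. x i * y j * (w k i * w k j))" by (rule sum.swap)
  also have "\<dots> = (\<Sum>i<n. \<Sum>j<n. \<Sum>k<n. x i * y j * (w k i * w k j))"
    by (rule sum.cong[OF refl], rule sum.swap)
  also have "\<dots> = (\<Sum>i<n. \<Sum>j<n. if j = i then x i * y j else 0)"
    unfolding sum_distrib_left[symmetric] using complete by (intro sum.cong) auto
  finally show ?thesis by simp
qed

lemma bilinear_form_eq:
  "(\<Sum>i<n. \<Sum>j<n. A i j * x i * y j) = (\<Sum>k<n. lam k * coord k x * coord k y)"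
proof -
  have "(\<Sum>k<n. lam k * coord k x * coord k y)
      = (\<Sum>k<n. \<Sum>i<n. \<Sum>j<n. lam k * w k i * w k j * (x i * y j))"
    unfolding coord_def mult.assoc unfolding sum_product unfolding sum_distrib_left
    by (intro sum.cong) (auto simp: mult_ac)
  also have "\<dots> = (\<Sum>i<n. \<Sum>k<n. \<Sum>j<n. lam k * w k i * w k j * (x i * y j))" by (rule sum.swap)
  also have "\<dots> = (\<Sum>i<n. \<Sum>j<n. \<Sum>k<n. lam k * w k i * w k j * (x i * y j))"
    by (rule sum.cong[OF refl], rule sum.swap)
  also have "\<dots> = (\<Sum>i<n. \<Sum>j<n. A i j * x i * y j)"
    unfolding sum_distrib_right[symmetric] using expansion
    by (intro sum.cong) (auto simp: mult.assoc)
  finally show ?thesis by simp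
qed

lemma coord_basis: "k < n \<Longrightarrow> l < n \<Longrightarrow> coord k (w l) = (if k = l then 1 else 0)"
  unfolding coord_def by (rule orthonormal)

lemma quadratic_form_basis:
  assumes "k < n"
  shows "(\<Sum>i<n. \<Sum>j<n. A i j * w k i * w k j) = lam k"
proof -
  have "(\<Sum>i<n. \<Sum>j<n. A i j * w k i * w k j) = (\<Sum>l<n. if l = k then lam l else 0)"
    unfolding bilinear_form_eq using assms by (intro sum.cong) (auto simp: coord_basis)
  then show ?thesis using assms by simp
qed

text \<open>
  In the eigenbasis, the quadratic form is a combination of squares with weights \<open>lam k\<close>, and the
  squared norm is the same combination with weights 1.
\<close>
lemma quadratic_form_ge:
  assumes "\<And>k. k < n \<Longrightarrow> mu \<le> lam k"
  shows "mu * (\<Sum>i<n. x i * x i) \<le> (\<Sum>i<n. \<Sum>j<n. A i j * x i * x j)"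
proof -
  have "mu * (\<Sum>k<n. coord k x * coord k x) \<le> (\<Sum>k<n. lam k * coord k x * coord k x)"
    unfolding sum_distrib_left mult.assoc
    using assms by (intro sum_mono mult_right_mono) auto
  then show ?thesis by (simp only: parseval[of x x] bilinear_form_eq[of x x])
qed

text \<open>
  Nonnegativity of the trace of \<open>N (A - mu I)\<close> for positive semidefinite \<open>N\<close>: expanding
  \<open>A - mu I\<close> in the eigenvectors of \<open>A\<close> turns the trace into the sum of the values of \<open>N\<close> at
  the vectors \<open>w k\<close> with the weights \<open>lam k - mu \<ge> 0\<close>.
\<close>
lemma trace_product_nonneg:
  assumes mu: "\<And>k. k < n \<Longrightarrow> mu \<le> lam k"
    and N: "\<And>x :: nat \<Rightarrow> real. 0 \<le> (\<Sum>i<n. \<Sum>j<n. N i j * x i * x j)"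
  shows "0 \<le> (\<Sum>i<n. \<Sum>j<n. N i j * (A i j - (if i = j then mu else 0)))"
proof -
  have "0 \<le> (lam k - mu) * (\<Sum>i<n. \<Sum>j<n. N i j * w k i * w k j)" if "k < n" for k
    using mu[OF that] N by (intro mult_nonneg_nonneg) auto
  then have "0 \<le> (\<Sum>k<n. (lam k - mu) * (\<Sum>i<n. \<Sum>j<n. N i j * w k i * w k j))"
    by (intro sum_nonneg) auto
  also have "\<dots> = (\<Sum>k<n. \<Sum>i<n. \<Sum>j<n. N i j * (lam k * w k i * w k j - mu * (w k i * w k j)))"
    unfolding sum_distrib_left by (intro sum.cong) (auto simp: algebra_simps)
  also have "\<dots> = (\<Sum>i<n. \<Sum>k<n. \<Sum>j<n. N i j * (lam k * w k i * w k j - mu * (w k i * w k j)))"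
    by (rule sum.swap)
  also have "\<dots> = (\<Sum>i<n. \<Sum>j<n. \<Sum>k<n. N i j * (lam k * w k i * w k j - mu * (w k i * w k j)))"
    by (rule sum.cong[OF refl], rule sum.swap)
  also have "\<dots> = (\<Sum>i<n. \<Sum>j<n. N i j * (A i j - (if i = j then mu else 0)))"
    unfolding sum_distrib_left[symmetric] sum_subtractf
    using expansion complete by (intro sum.cong) auto
  finally show ?thesis .
qed

end

section \<open>Adjacency forms of regular graphs\<close>

locale regular_spectral_decomposition = spectral_decomposition +
  fixes d :: nat
  assumes symmetric: "i < n \<Longrightarrow> j < n \<Longrightarrow> A i j = A j i"
    and nonneg: "i < n \<Longrightarrow> j < n \<Longrightarrow> 0 \<le> A i j"
    and row_sum: "i < n \<Longrightarrow> (\<Sum>j<n. A i j) = real d"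
begin

lemma col_sum: "j < n \<Longrightarrow> (\<Sum>i<n. A i j) = real d"
  using row_sum[of j] symmetric[of j] by (simp cong: sum.cong_simp)

text \<open>
  Twice the difference of the two sides is the Laplacian form, that is, the sum of
  \<open>A i j (x i - x j)\<^sup>2\<close>.
\<close>
lemma quadratic_form_le_degree:
  "(\<Sum>i<n. \<Sum>j<n. A i j * x i * x j) \<le> real d * (\<Sum>i<n. x i * x i)"
proof -
  have "0 \<le> (\<Sum>i<n. \<Sum>j<n. A i j * (x i - x j)\<^sup>2)"
    using nonneg by (intro sum_nonneg mult_nonneg_nonneg) auto
  also have "\<dots> = (\<Sum>i<n. \<Sum>j<n. A i j * (x i * x i)) + (\<Sum>i<n. \<Sum>j<n. A i j * (x j * x j))
      - 2 * (\<Sum>i<n. \<Sum>j<n. A i j * x i * x j)"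
    unfolding sum_distrib_left sum.distrib[symmetric] sum_subtractf[symmetric]
    by (intro sum.cong) (auto simp: power2_eq_square algebra_simps)
  also have "(\<Sum>i<n. \<Sum>j<n. A i j * (x i * x i)) = real d * (\<Sum>i<n. x i * x i)"
    unfolding sum_distrib_right[symmetric] sum_distrib_left by (simp add: row_sum cong: sum.cong_simp)
  also have "(\<Sum>i<n. \<Sum>j<n. A i j * (x j * x j)) = real d * (\<Sum>i<n. x i * x i)"
    unfolding sum_distrib_left
    by (subst sum.swap, unfold sum_distrib_right[symmetric]) (simp add: col_sum cong: sum.cong_simp)
  finally show ?thesis by simp
qed

lemma eigenvalue_le_degree:
  assumes "k < n"
  shows "lam k \<le> real d"
  using quadratic_form_le_degree[of "w k"] quadratic_form_basis[OF assms] orthonormal[OF assms assms]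
  by simp

text \<open>
  The all-ones vector is an eigenvector for \<open>d\<close>, hence orthogonal to the eigenvectors for every
  other eigenvalue.
\<close>
lemma coord_ones:
  assumes k: "k < n"
  shows "(lam k - real d) * coord k (\<lambda>_. 1) = 0"
proof -
  have "(\<Sum>i<n. \<Sum>j<n. A i j * w k i * 1) = (\<Sum>l<n. if l = k then lam l * coord l (\<lambda>_. 1) else 0)"
    unfolding bilinear_form_eq using k by (intro sum.cong) (auto simp: coord_basis)
  moreover have "(\<Sum>i<n. \<Sum>j<n. A i j * w k i * 1) = real d * coord k (\<lambda>_. 1)"
    unfolding sum_distrib_right[symmetric] coord_def by (simp add: row_sum sum_distrib_left cong: sum.cong_simp)
  ultimately show ?thesis using k by (simp add: algebra_simps)
qed

text \<open>
  If \<open>mu = d\<close>, this is the bound by the degree. If \<open>mu < d\<close>, the eigenvectors \<open>w k\<close> with \<open>k > 0\<close>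
  belong to eigenvalues other than \<open>d\<close>, so the all-ones vector is a multiple of \<open>w 0\<close>; the square
  of the coordinate of \<open>x\<close> along \<open>w 0\<close> is then the square of the sum of \<open>x\<close> divided by \<open>n\<close>, and all
  other coordinates contribute with a weight of at most \<open>mu\<close>.
\<close>
lemma quadratic_form_le_second:
  assumes n: "0 < n" and le: "\<And>k. 0 < k \<Longrightarrow> k < n \<Longrightarrow> lam k \<le> mu" and mu: "mu \<le> real d"
  shows "(\<Sum>i<n. \<Sum>j<n. A i j * x i * x j)
    \<le> mu * (\<Sum>i<n. x i * x i) + (real d - mu) * (\<Sum>i<n. x i)\<^sup>2 / real n"
proof (cases "mu = real d")
  case True
  then show ?thesis using quadratic_form_le_degree by simp
next
  case False
  let ?one = "\<lambda>_. 1 :: real"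
  have one: "coord k ?one = 0" if "0 < k" "k < n" for k
    using coord_ones[OF that(2)] le[OF that] mu False by auto
  obtain m where m: "n = Suc m" using n by (cases n) auto
  have first: "(\<Sum>k<n. f k) = f 0 + (\<Sum>k<m. f (Suc k))" for f :: "nat \<Rightarrow> real"
    unfolding m by (rule sum.lessThan_Suc_shift)
  have "real n = (\<Sum>i<n. ?one i * ?one i)" by simp
  also have "\<dots> = coord 0 ?one * coord 0 ?one"
    unfolding parseval[of ?one] first using one m by simp
  finally have c0: "real n = coord 0 ?one * coord 0 ?one" .
  then have "coord 0 ?one \<noteq> 0" using n by auto
  have "(\<Sum>i<n. x i) = (\<Sum>i<n. ?one i * x i)" by simp
  also have "\<dots> = coord 0 ?one * coord 0 x"
    unfolding parseval[of ?one] first using one m by simp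
  finally have "(real d - mu) * (\<Sum>i<n. x i)\<^sup>2 / real n
      = (real d - mu) * (coord 0 x * coord 0 x)"
    using \<open>coord 0 ?one \<noteq> 0\<close> by (simp add: c0 power2_eq_square)
  moreover have "(\<Sum>i<n. \<Sum>j<n. A i j * x i * x j)
      \<le> real d * (coord 0 x * coord 0 x) + mu * (\<Sum>k<m. coord (Suc k) x * coord (Suc k) x)"
  proof -
    have "lam 0 * (coord 0 x * coord 0 x) \<le> real d * (coord 0 x * coord 0 x)"
      using eigenvalue_le_degree[OF n] by (intro mult_right_mono) auto
    moreover have "(\<Sum>k<m. lam (Suc k) * (coord (Suc k) x * coord (Suc k) x))
        \<le> (\<Sum>k<m. mu * (coord (Suc k) x * coord (Suc k) x))"
      using le m by (intro sum_mono mult_right_mono) auto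
    ultimately show ?thesis
      unfolding bilinear_form_eq[of x x] first[of "\<lambda>k. lam k * coord k x * coord k x"]
      by (simp add: mult.assoc sum_distrib_left)
  qed
  moreover have "(\<Sum>i<n. x i * x i) = coord 0 x * coord 0 x
      + (\<Sum>k<m. coord (Suc k) x * coord (Suc k) x)"
    unfolding parseval[of x x] first by simp
  ultimately show ?thesis by (simp only:) (simp add: algebra_simps)
qed

end

text \<open>
  The test vector that fixes the signs of the two eigenvalues: the difference of the indicators of
  two vertices sums to zero, and its quadratic form only sees the entries between the two.
\<close>
lemma quadratic_form_two_vertices:
  fixes A :: "nat \<Rightarrow> nat \<Rightarrow> real"
  assumes "p < n" "q < n" "p \<noteq> q"
  defines "x \<equiv> (\<lambda>i. (if i = p then 1 else 0) - (if i = q then 1 else 0) :: real)"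
  shows "(\<Sum>i<n. \<Sum>j<n. A i j * x i * x j) = A p p + A q q - A p q - A q p"
    and "(\<Sum>i<n. x i * x i) = 2" and "(\<Sum>i<n. x i) = 0"
proof -
  have row: "(\<Sum>j<n. A i j * x i * x j) = (A i p - A i q) * x i" for i
  proof -
    have "(\<Sum>j<n. A i j * x i * x j)
        = (\<Sum>j<n. (if j = p then A i j * x i else 0) - (if j = q then A i j * x i else 0))"
      unfolding x_def by (intro sum.cong) auto
    then show ?thesis using assms(1,2) by (simp add: sum_subtractf algebra_simps)
  qed
  have "(\<Sum>i<n. \<Sum>j<n. A i j * x i * x j)
      = (\<Sum>i<n. (if i = p then A i p - A i q else 0) - (if i = q then A i p - A i q else 0))"
    unfolding row unfolding x_def by (intro sum.cong) auto
  then show "(\<Sum>i<n. \<Sum>j<n. A i j * x i * x j) = A p p + A q q - A p q - A q p"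
    using assms(1,2) by (simp add: sum_subtractf)
  have "(\<Sum>i<n. x i * x i) = (\<Sum>i<n. (if i = p then 1 else 0) + (if i = q then 1 else 0))"
    using assms(3) unfolding x_def by (intro sum.cong) auto
  then show "(\<Sum>i<n. x i * x i) = 2" using assms(1,2) by (simp add: sum.distrib)
  show "(\<Sum>i<n. x i) = 0" using assms(1,2) by (simp add: x_def sum_subtractf)
qed

section \<open>From graphs to spectral decompositions\<close>

lemma proots_prod_list_linear: "proots (\<Prod>a\<leftarrow>as. [:- a, 1:]) = mset (as :: real list)"
proof (induction as)
  case (Cons a as)
  have "(\<Prod>a\<leftarrow>as. [:- a, 1:]) \<noteq> 0" by (auto simp: prod_list_zero_iff)
  then have "proots ([:- a, 1:] * (\<Prod>a\<leftarrow>as. [:- a, 1:])) =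
      proots [:- a, 1:] + proots (\<Prod>a\<leftarrow>as. [:- a, 1:])"
    by (intro proots_mult) auto
  then show ?case unfolding list.map prod_list.Cons by (simp only: Cons.IH) simp
qed simp

lemma graph_eigenvalues_decreasing:
  assumes "i \<le> j" "j < length (graph_eigenvalues G)"
  shows "graph_eigenvalues G ! j \<le> graph_eigenvalues G ! i"
proof -
  have "sorted (rev (graph_eigenvalues G))" by (simp add: graph_eigenvalues_def)
  then show ?thesis using assms by (simp add: sorted_rev_iff_nth_mono)
qed

lemma (in pair_graph) graph_regular_spectral_decomposition:
  assumes vs: "distinct vs" "set vs = pverts G" and reg: "regular_graph d G"
  obtains w where "regular_spectral_decomposition (length vs)
    (\<lambda>i j. of_bool ((vs ! i, vs ! j) \<in> parcs G)) (nth (graph_eigenvalues G)) w d"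
proof -
  let ?n = "length vs" and ?A = "adjacency_mat G vs"
  have sym: "(u, v) \<in> parcs G \<longleftrightarrow> (v, u) \<in> parcs G" for u v
    using pair_sym_arcs by (auto simp: symmetric_def sym_def)
  have At: "transpose_mat ?A = ?A"
    by (rule eq_matI) (auto simp: adjacency_mat_def sym)
  obtain as where as: "char_poly ?A = (\<Prod>a\<leftarrow>as. [:- a, 1:])"
    using char_poly_symmetric_splits[OF adjacency_mat_carrier At] by blast
  have "mset (graph_eigenvalues G) = mset as"
    unfolding graph_eigenvalues_eq[OF vs] as by (simp add: proots_prod_list_linear)
  \<comment> \<open>The order of the linear factors is free, so the sorted list of eigenvalues can be used.\<close>
  then have "mset (map (\<lambda>a. [:- a, 1:]) (graph_eigenvalues G)) = mset (map (\<lambda>a. [:- a, 1:]) as)"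
    by simp
  then have cp: "char_poly ?A = (\<Prod>a\<leftarrow>graph_eigenvalues G. [:- a, 1:])"
    unfolding as by (metis prod_mset_prod_list)
  obtain w where w: "spectral_decomposition ?n (\<lambda>i j. ?A $$ (i, j)) (nth (graph_eigenvalues G)) w"
    using symmetric_mat_spectral_decomposition[OF adjacency_mat_carrier At cp] .
  have row: "(\<Sum>j<?n. of_bool ((vs ! i, vs ! j) \<in> parcs G)) = real d" if i: "i < ?n" for i
  proof -
    have bij: "bij_betw (nth vs) {..<?n} (pverts G)"
      using bij_betw_nth[OF vs(1) refl] vs(2) by simp
    have "(\<Sum>j<?n. of_bool ((vs ! i, vs ! j) \<in> parcs G))
        = (\<Sum>v\<in>pverts G. of_bool ((vs ! i, v) \<in> parcs G) :: real)"
      by (rule sum.reindex_bij_betw[OF bij])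
    also have "\<dots> = real (card {v \<in> pverts G. (vs ! i, v) \<in> parcs G})"
      by (simp add: sum.If_cases of_bool_def Int_def)
    also have "card {v \<in> pverts G. (vs ! i, v) \<in> parcs G}
        = card (Pair (vs ! i) ` {v \<in> pverts G. (vs ! i, v) \<in> parcs G})"
      by (rule card_image[symmetric]) (simp add: inj_on_def)
    also have "Pair (vs ! i) ` {v \<in> pverts G. (vs ! i, v) \<in> parcs G}
        = out_arcs (with_proj G) (vs ! i)"
      using in_arcsD2 by (auto simp: out_arcs_def)
    also have "card \<dots> = d"
      using reg vs(2) i unfolding regular_graph_def out_degree_def by auto
    finally show ?thesis .
  qed
  interpret spectral_decomposition ?n "\<lambda>i j. ?A $$ (i, j)" "nth (graph_eigenvalues G)" w
    by (rule w)
  have "regular_spectral_decomposition ?n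
    (\<lambda>i j. of_bool ((vs ! i, vs ! j) \<in> parcs G)) (nth (graph_eigenvalues G)) w d"
  proof
    fix i j assume "i < ?n" "j < ?n"
    then show "of_bool ((vs ! i, vs ! j) \<in> parcs G)
        = (\<Sum>k<?n. graph_eigenvalues G ! k * w k i * w k j)"
      using expansion[of i j] by (auto simp: adjacency_mat_def)
  qed (use orthonormal complete row sym in auto)
  then show thesis using that by blast
qed

theorem corollary4p2:
  fixes G H :: "'a pair_pre_digraph" and n d d' :: nat
  assumes "pair_graph G" and "pair_graph H"
    and "card (pverts G) = n" and "card (pverts H) = n"
    and "\<not> complete_graph G" and "\<not> complete_graph H"
    and "nonempty_graph G" and "nonempty_graph H"
    and "regular_graph d G" and "regular_graph d' H"
    and "d' \<le> d"
    and "spanning (with_proj H) (with_proj G)"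
  shows "real n * (1 + graph_eigenvalue 2 G) / (real n - real d + graph_eigenvalue 2 G)
    + real d' / graph_eigenvalue n H \<ge> 1"
proof -
  interpret G: pair_graph G by fact
  interpret H: pair_graph H by fact
  define vs where "vs = vertex_enum G"
  have vs: "distinct vs" "set vs = pverts G"
    using vertex_enum[OF G.pair_finite_verts] by (auto simp: vs_def)
  have len: "length vs = n" using vs assms(3) distinct_card by metis
  have verts: "pverts H = pverts G" and arcs: "parcs H \<subseteq> parcs G"
    using assms(12) by (auto simp: spanning_def subgraph_def)
  define a where "a = (\<lambda>i j. of_bool ((vs ! i, vs ! j) \<in> parcs G) :: real)"
  define b where "b = (\<lambda>i j. of_bool ((vs ! i, vs ! j) \<in> parcs H) :: real)"
  obtain w where "regular_spectral_decomposition n a (nth (graph_eigenvalues G)) w d"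
    using G.graph_regular_spectral_decomposition[OF vs assms(9)] unfolding len a_def .
  then interpret A: regular_spectral_decomposition n a "nth (graph_eigenvalues G)" w d .
  have vsH: "set vs = pverts H" using vs verts by simp
  obtain z where "regular_spectral_decomposition n b (nth (graph_eigenvalues H)) z d'"
    using H.graph_regular_spectral_decomposition[OF vs(1) vsH assms(10)] unfolding len b_def .
  then interpret B: regular_spectral_decomposition n b "nth (graph_eigenvalues H)" z d' .
  have index: "\<exists>p<n. vs ! p = v" if "v \<in> pverts G" for v
    using that vs len by (metis in_set_conv_nth)
  have loopG: "(v, v) \<notin> parcs G" for v using G.no_loops[of "(v, v)"] by auto
  have symG: "(u, v) \<in> parcs G \<longleftrightarrow> (v, u) \<in> parcs G" for u v
    using G.pair_sym_arcs by (auto simp: symmetric_def sym_def)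
  have symH: "(u, v) \<in> parcs H \<longleftrightarrow> (v, u) \<in> parcs H" for u v
    using H.pair_sym_arcs by (auto simp: symmetric_def sym_def)
  have loop: "a i i = 0" "b i i = 0" for i using loopG arcs by (auto simp: a_def b_def)

  obtain e where "e \<in> parcs H" using assms(8) by (auto simp: nonempty_graph_def)
  then obtain u v where uv: "(u, v) \<in> parcs H" by (cases e) auto
  then have "u \<in> pverts G" "v \<in> pverts G" using H.in_arcsD1 H.in_arcsD2 verts by auto
  then obtain p q where pq: "p < n" "q < n" "vs ! p = u" "vs ! q = v" using index by metis
  have "p \<noteq> q" using pq uv arcs loopG by auto
  then have n: "2 \<le> n" using pq by linarith

  define \<theta> where "\<theta> = graph_eigenvalue 2 G"
  define \<mu> where "\<mu> = graph_eigenvalue n H"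
  have lenG: "length (graph_eigenvalues G) = n" and lenH: "length (graph_eigenvalues H) = n"
    using G.length_graph_eigenvalues H.length_graph_eigenvalues assms(3,4) by auto
  have le_\<theta>: "graph_eigenvalues G ! k \<le> \<theta>" if "0 < k" "k < n" for k
    using graph_eigenvalues_decreasing[of 1 k G] that lenG
    by (simp add: \<theta>_def graph_eigenvalue_def)
  have \<mu>le: "\<mu> \<le> graph_eigenvalues H ! k" if "k < n" for k
    using graph_eigenvalues_decreasing[of k "n - 1" H] that lenH
    by (simp add: \<mu>_def graph_eigenvalue_def)
  have "\<theta> \<le> real d"
    using A.eigenvalue_le_degree[of 1] n by (simp add: \<theta>_def graph_eigenvalue_def)
  note second = A.quadratic_form_le_second[OF _ le_\<theta> this]

  have "b p q = 1" "b q p = 1" using uv symH pq by (auto simp: b_def)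
  \<comment> \<open>The ends of an edge of \<open>H\<close> witness \<open>\<mu> \<le> - 1\<close>.\<close>
  have "\<mu> * 2 \<le> - 2"
    using B.quadratic_form_ge[OF \<mu>le, of "\<lambda>i. (if i = p then 1 else 0) - (if i = q then 1 else 0)"]
    unfolding quadratic_form_two_vertices[OF pq(1,2) \<open>p \<noteq> q\<close>] using \<open>b p q = 1\<close> \<open>b q p = 1\<close> loop
    by simp
  then have "\<mu> < 0" by simp

  \<comment> \<open>Two nonadjacent vertices of \<open>G\<close> witness \<open>\<theta> \<ge> 0\<close>.\<close>
  obtain s t where st: "s < n" "t < n" "s \<noteq> t" "a s t = 0" "a t s = 0"
  proof -
    have "arcs_ends (with_proj G) \<noteq> {(u,v). (u,v) \<in> pverts G \<times> pverts G \<and> u \<noteq> v}"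
      using assms(5) G.graph_axioms unfolding complete_graph_def complete_digraph_def by auto
    moreover have "parcs G \<subseteq> {(u,v). (u,v) \<in> pverts G \<times> pverts G \<and> u \<noteq> v}"
      using G.in_arcsD1 G.in_arcsD2 loopG by auto
    ultimately obtain u v where "u \<in> pverts G" "v \<in> pverts G" "u \<noteq> v" "(u, v) \<notin> parcs G"
      by (auto simp: arcs_ends_def arc_to_ends_def)
    then show ?thesis using that index symG unfolding a_def by (metis of_bool_eq(1))
  qed
  have "\<theta> \<ge> 0"
    using second[of "\<lambda>i. (if i = s then 1 else 0) - (if i = t then 1 else 0)"]
    unfolding quadratic_form_two_vertices[OF st(1-3)] using n st(4,5) loop by simp

  have "d < n"
  proof -
    have "real d = (\<Sum>j<n. a p j)" using A.row_sum pq by simp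
    also have "\<dots> = (\<Sum>j\<in>{..<n} - {p}. a p j)"
      using pq loop by (subst sum.remove[of _ p]) auto
    also have "\<dots> \<le> (\<Sum>j\<in>{..<n} - {p}. 1)" by (intro sum_mono) (simp add: a_def)
    also have "\<dots> < real n" using pq by simp
    finally show ?thesis by simp
  qed

  \<comment> \<open>\<open>second\<close> says precisely that this matrix is positive semidefinite.\<close>
  define N where "N = (\<lambda>i j. (if i = j then \<theta> else 0) + (real d - \<theta>) / real n - a i j)"
  have N: "0 \<le> (\<Sum>i<n. \<Sum>j<n. N i j * x i * x j)" for x :: "nat \<Rightarrow> real"
  proof -
    have "(\<Sum>i<n. \<Sum>j<n. N i j * x i * x j)
      = (\<Sum>i<n. \<Sum>j<n. (if j = i then \<theta> * (x i * x j) else 0)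
          + (real d - \<theta>) / real n * (x i * x j) - a i j * x i * x j)"
      unfolding N_def by (intro sum.cong) (auto simp: algebra_simps)
    also have "\<dots> = \<theta> * (\<Sum>i<n. x i * x i) + (real d - \<theta>) / real n * (\<Sum>i<n. x i)\<^sup>2
        - (\<Sum>i<n. \<Sum>j<n. a i j * x i * x j)"
      unfolding sum_subtractf sum.distrib power2_eq_square sum_product
      by (simp add: sum_distrib_left)
    finally show ?thesis using second[of x] n by simp
  qed
  have "0 \<le> (\<Sum>i<n. \<Sum>j<n. N i j * (b i j - (if i = j then \<mu> else 0)))"
    using B.trace_product_nonneg[OF \<mu>le N] .
  also have "\<dots> = (\<Sum>i<n. \<Sum>j<n. ((real d - \<theta>) / real n - 1) * b i j
      - (if j = i then (\<theta> + (real d - \<theta>) / real n) * \<mu> else 0))"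
  proof (intro sum.cong refl)
    fix i j
    \<comment> \<open>This is where \<open>H\<close> being a subgraph of \<open>G\<close> enters.\<close>
    have "a i j * b i j = b i j" using arcs by (auto simp: a_def b_def)
    then show "N i j * (b i j - (if i = j then \<mu> else 0)) = ((real d - \<theta>) / real n - 1) * b i j
      - (if j = i then (\<theta> + (real d - \<theta>) / real n) * \<mu> else 0)"
      using loop by (auto simp: N_def algebra_simps)
  qed
  also have "\<dots> = (\<Sum>i<n. ((real d - \<theta>) / real n - 1) * real d'
      - (\<theta> + (real d - \<theta>) / real n) * \<mu>)"
    by (simp add: sum_subtractf sum_distrib_left[symmetric] B.row_sum)
  also have "\<dots> = (real d - \<theta> - real n) * real d' - (real n * \<theta> + real d - \<theta>) * \<mu>"
    using n by (simp add: field_simps)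
  finally have main: "(real n - real d + \<theta>) * (real d' - \<mu>) \<le> real n * (1 + \<theta>) * (- \<mu>)"
    by (simp add: algebra_simps)
  have "0 < real n - real d + \<theta>" using \<open>d < n\<close> \<open>\<theta> \<ge> 0\<close> by simp
  then have "(real d' - \<mu>) / (- \<mu>) \<le> real n * (1 + \<theta>) / (real n - real d + \<theta>)"
    using main \<open>\<mu> < 0\<close> by (simp add: field_simps)
  moreover have "(real d' - \<mu>) / (- \<mu>) = 1 - real d' / \<mu>"
    using \<open>\<mu> < 0\<close> by (simp add: field_simps)
  ultimately show ?thesis by (simp add: \<theta>_def \<mu>_def)
qed

end
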